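(* Let $\mathcal H$ be a complete Heyting algebra. Then the category $\mathbf{Set}^{\mathcal H^{op}}$ of presheaves on $\mathcal H$ is equivalent to the category $\mathbf{Rel}^{\mathcal H^{co}}_{\mathbf{Ord}}$ of relational-presheaves for $\mathcal H$.
   Context: $\mathbf{Set}^{\mathcal H^{op}}$ is the category of functors $\mathcal H^{op}\to\mathbf{Set}$ ($\mathcal H$ viewed as a poset category) and natural transformations. A relation $R:A\to B$ is a subset of $B\times A$; $R(b,a)=1$ means $(b,a)\in R$; $(S\circ R)(c,a)=1$ iff there is $b$ with $S(c,b)=1$ and $R(b,a)=1$; $R^{-1}$ is the inverse relation. An order-preserving family $\tau:A\to B$ is a family of relations $\langle\tau_h:A\to B\rangle_{h\in\mathcal H}$ such that for all $a\in A,b\in B$ the set $\{h\mid\tau_h(b,a)=1\}$ is down-closed in $\mathcal H$. The composite of order-preserving families $\tau:A\to B$, $\sigma:B\to C$ is given by: $(\sigma\tau)_h(c,a)=1$ iff there exist $k,l\in\mathcal H$ with $h\le k\wedge l$ and $(\sigma_k\circ\tau_l)(c,a)=1$. Write $\tau\le\sigma$ if $\tau_h\subseteq\sigma_h$ for all $h$, and $\tau^\circ=\langle\tau_h^{-1}\rangle_h$. A relational-presheaf $F$ for $\mathcal H$ is a set $F( * )$ with an order-preserving family $F=\langle F(h)\rangle_{h\in\mathcal H}:F( * )\to F( * )$ such that $F^\circ=F$ and $FF=F$. A morphism $\theta:F\Rightarrow G$ of relational-presheaves is an order-preserving family $\theta:F( * )\to G( * )$ with $\theta F=\theta=G\theta$,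 $F\le\theta^\circ\theta$ and $\theta\theta^\circ\le G$. Relational-presheaves and their morphisms, with morphisms composed by the composition $\sigma\tau$ of order-preserving families and with $F$ as identity on $F$, form the category $\mathbf{Rel}^{\mathcal H^{co}}_{\mathbf{Ord}}$. *)

theory Defs
  imports "HOL-Library.FuncSet"
begin

section \<open>Categories, functors, natural transformations\<close>

text \<open>Hom-sets need not be disjoint, so identities, composition and the action of functors on
  morphisms take the objects involved as arguments. \<open>Comp C X Y Z g f\<close> is the composite of
  \<open>f : X \<rightarrow> Y\<close> and \<open>g : Y \<rightarrow> Z\<close>.\<close>

record ('o, 'm) cat =
  Obj :: "'o set"
  Hom :: "'o \<Rightarrow> 'o \<Rightarrow> 'm set"
  Id :: "'o \<Rightarrow> 'm"
  Comp :: "'o \<Rightarrow> 'o \<Rightarrow> 'o \<Rightarrow> 'm \<Rightarrow> 'm \<Rightarrow> 'm"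

locale category =
  fixes C :: "('o, 'm) cat"
  assumes Id_Hom: "X \<in> Obj C \<Longrightarrow> Id C X \<in> Hom C X X"
    and Comp_Hom: "\<lbrakk>X \<in> Obj C; Y \<in> Obj C; Z \<in> Obj C; f \<in> Hom C X Y; g \<in> Hom C Y Z\<rbrakk>
      \<Longrightarrow> Comp C X Y Z g f \<in> Hom C X Z"
    and Comp_Id_left: "\<lbrakk>X \<in> Obj C; Y \<in> Obj C; f \<in> Hom C X Y\<rbrakk>
      \<Longrightarrow> Comp C X Y Y (Id C Y) f = f"
    and Comp_Id_right: "\<lbrakk>X \<in> Obj C; Y \<in> Obj C; f \<in> Hom C X Y\<rbrakk>
      \<Longrightarrow> Comp C X X Y f (Id C X) = f"
    and Comp_assoc: "\<lbrakk>W \<in> Obj C; X \<in> Obj C; Y \<in> Obj C; Z \<in> Obj C;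
        f \<in> Hom C W X; g \<in> Hom C X Y; h \<in> Hom C Y Z\<rbrakk>
      \<Longrightarrow> Comp C W Y Z h (Comp C W X Y g f) = Comp C W X Z (Comp C X Y Z h g) f"

definition op_cat :: "('o, 'm) cat \<Rightarrow> ('o, 'm) cat" where
  "op_cat C = \<lparr>Obj = Obj C, Hom = (\<lambda>X Y. Hom C Y X), Id = Id C,
     Comp = (\<lambda>X Y Z g f. Comp C Z Y X f g)\<rparr>"

definition is_iso :: "('o, 'm) cat \<Rightarrow> 'o \<Rightarrow> 'o \<Rightarrow> 'm \<Rightarrow> bool" where
  "is_iso C X Y f \<longleftrightarrow> f \<in> Hom C X Y \<and>
     (\<exists>g\<in>Hom C Y X. Comp C X Y X g f = Id C X \<and> Comp C Y X Y f g = Id C Y)"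

record ('o1, 'm1, 'o2, 'm2) cfunctor =
  omap :: "'o1 \<Rightarrow> 'o2"
  amap :: "'o1 \<Rightarrow> 'o1 \<Rightarrow> 'm1 \<Rightarrow> 'm2"

definition is_functor ::
    "('o1, 'm1) cat \<Rightarrow> ('o2, 'm2) cat \<Rightarrow> ('o1, 'm1, 'o2, 'm2) cfunctor \<Rightarrow> bool" where
  "is_functor C D F \<longleftrightarrow>
     (\<forall>X\<in>Obj C. omap F X \<in> Obj D) \<and>
     (\<forall>X\<in>Obj C. \<forall>Y\<in>Obj C. \<forall>f\<in>Hom C X Y. amap F X Y f \<in> Hom D (omap F X) (omap F Y)) \<and>
     (\<forall>X\<in>Obj C. amap F X X (Id C X) = Id D (omap F X)) \<and>
     (\<forall>X\<in>Obj C. \<forall>Y\<in>Obj C. \<forall>Z\<in>Obj C. \<forall>f\<in>Hom C X Y. \<forall>g\<in>Hom C Y Z.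
        amap F X Z (Comp C X Y Z g f)
          = Comp D (omap F X) (omap F Y) (omap F Z) (amap F Y Z g) (amap F X Y f))"

definition id_functor :: "('o, 'm, 'o, 'm) cfunctor" where
  "id_functor = \<lparr>omap = (\<lambda>X. X), amap = (\<lambda>X Y f. f)\<rparr>"

definition comp_functor :: "('o2, 'm2, 'o3, 'm3) cfunctor \<Rightarrow> ('o1, 'm1, 'o2, 'm2) cfunctor
    \<Rightarrow> ('o1, 'm1, 'o3, 'm3) cfunctor" where
  "comp_functor G F = \<lparr>omap = (\<lambda>X. omap G (omap F X)),
     amap = (\<lambda>X Y f. amap G (omap F X) (omap F Y) (amap F X Y f))\<rparr>"

definition is_nat_trans :: "('o1, 'm1) cat \<Rightarrow> ('o2, 'm2) cat \<Rightarrow> ('o1, 'm1, 'o2, 'm2) cfunctor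
    \<Rightarrow> ('o1, 'm1, 'o2, 'm2) cfunctor \<Rightarrow> ('o1 \<Rightarrow> 'm2) \<Rightarrow> bool" where
  "is_nat_trans C D F G \<eta> \<longleftrightarrow>
     (\<forall>X\<in>Obj C. \<eta> X \<in> Hom D (omap F X) (omap G X)) \<and>
     (\<forall>X\<in>Obj C. \<forall>Y\<in>Obj C. \<forall>f\<in>Hom C X Y.
        Comp D (omap F X) (omap F Y) (omap G Y) (\<eta> Y) (amap F X Y f)
          = Comp D (omap F X) (omap G X) (omap G Y) (amap G X Y f) (\<eta> X))"

definition is_nat_iso :: "('o1, 'm1) cat \<Rightarrow> ('o2, 'm2) cat \<Rightarrow> ('o1, 'm1, 'o2, 'm2) cfunctor
    \<Rightarrow> ('o1, 'm1, 'o2, 'm2) cfunctor \<Rightarrow> ('o1 \<Rightarrow> 'm2) \<Rightarrow> bool" where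
  "is_nat_iso C D F G \<eta> \<longleftrightarrow> is_nat_trans C D F G \<eta> \<and>
     (\<forall>X\<in>Obj C. is_iso D (omap F X) (omap G X) (\<eta> X))"

definition equivalent_categories :: "('o1, 'm1) cat \<Rightarrow> ('o2, 'm2) cat \<Rightarrow> bool" where
  "equivalent_categories C D \<longleftrightarrow> category C \<and> category D \<and>
     (\<exists>F G \<eta> \<epsilon>. is_functor C D F \<and> is_functor D C G \<and>
        is_nat_iso C C id_functor (comp_functor G F) \<eta> \<and>
        is_nat_iso D D (comp_functor F G) id_functor \<epsilon>)"

text \<open>As objects and morphisms of a functor category, functors and natural transformations are
  normalised to be \<open>undefined\<close> off their domains, so that equality of HOL values is equality of
  functors and of natural transformations.\<close>

definition functor_extensional ::
    "('o1, 'm1) cat \<Rightarrow> ('o1, 'm1, 'o2, 'm2) cfunctor \<Rightarrow> bool" where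
  "functor_extensional C F \<longleftrightarrow> omap F \<in> extensional (Obj C) \<and>
     (\<forall>X Y f. \<not> (X \<in> Obj C \<and> Y \<in> Obj C \<and> f \<in> Hom C X Y) \<longrightarrow> amap F X Y f = undefined)"

definition functor_cat :: "('o1, 'm1) cat \<Rightarrow> ('o2, 'm2) cat
    \<Rightarrow> (('o1, 'm1, 'o2, 'm2) cfunctor, 'o1 \<Rightarrow> 'm2) cat" where
  "functor_cat C D = \<lparr>
     Obj = {F. is_functor C D F \<and> functor_extensional C F},
     Hom = (\<lambda>F G. {\<eta>. is_nat_trans C D F G \<eta> \<and> \<eta> \<in> extensional (Obj C)}),
     Id = (\<lambda>F. \<lambda>X\<in>Obj C. Id D (omap F X)),
     Comp = (\<lambda>F G K \<kappa> \<eta>. \<lambda>X\<in>Obj C. Comp D (omap F X) (omap G X) (omap K X) (\<kappa> X) (\<eta> X))\<rparr>"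


section \<open>The category of sets\<close>

text \<open>HOL has no set of all sets, so the category of sets is taken relative to a notion of
  smallness for subsets of a type \<open>'u\<close> that is closed under the operations below. Every
  Grothendieck universe has these properties; so does \<open>small = (\<lambda>_. True)\<close> on any infinite type.\<close>

locale set_universe =
  fixes small :: "'u set \<Rightarrow> bool"
  assumes small_subset: "\<lbrakk>small A; B \<subseteq> A\<rbrakk> \<Longrightarrow> small B"
    and small_image: "small A \<Longrightarrow> small (f ` A)"
    and small_UN: "\<lbrakk>small I; \<And>i. i \<in> I \<Longrightarrow> small (X i)\<rbrakk> \<Longrightarrow> small (\<Union>i\<in>I. X i)"
    and pairing: "\<exists>pair :: 'u \<times> 'u \<Rightarrow> 'u. inj pair"

definition small_type :: "('u set \<Rightarrow> bool) \<Rightarrow> 'h itself \<Rightarrow> bool" where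
  "small_type small _ \<longleftrightarrow> (\<exists>e :: 'h \<Rightarrow> 'u. inj e \<and> small (range e))"

definition set_cat :: "('u set \<Rightarrow> bool) \<Rightarrow> ('u set, 'u \<Rightarrow> 'u) cat" where
  "set_cat small = \<lparr>Obj = {A. small A}, Hom = (\<lambda>A B. A \<rightarrow>\<^sub>E B), Id = (\<lambda>A. \<lambda>x\<in>A. x),
     Comp = (\<lambda>A B C g f. compose A g f)\<rparr>"


section \<open>Complete Heyting algebras and presheaves\<close>

class complete_heyting_algebra = complete_lattice +
  fixes himp :: "'a \<Rightarrow> 'a \<Rightarrow> 'a"
  assumes le_himp_iff: "a \<le> himp b c \<longleftrightarrow> inf a b \<le> c"

definition poset_cat :: "('h::order, unit) cat" where
  "poset_cat = \<lparr>Obj = UNIV, Hom = (\<lambda>h k. if h \<le> k then {()} else {}), Id = (\<lambda>h. ()),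
     Comp = (\<lambda>h k l g f. ())\<rparr>"

definition presheaf_cat ::
    "('u set \<Rightarrow> bool) \<Rightarrow> (('h::order, unit, 'u set, 'u \<Rightarrow> 'u) cfunctor, 'h \<Rightarrow> 'u \<Rightarrow> 'u) cat" where
  "presheaf_cat small = functor_cat (op_cat poset_cat) (set_cat small)"


section \<open>Relational presheaves\<close>

text \<open>A relation \<open>R : A \<rightarrow> B\<close> is a subset of \<open>B \<times> A\<close>; with this convention the composite of
  \<open>R : A \<rightarrow> B\<close> and \<open>S : B \<rightarrow> C\<close> is \<open>S O R\<close>. The order on families is the pointwise inclusion
  \<open>\<le>\<close> of the library.\<close>

type_synonym ('h, 'u) rel_family = "'h \<Rightarrow> ('u \<times> 'u) set"

definition order_preserving_family ::
    "'u set \<Rightarrow> 'u set \<Rightarrow> ('h::order, 'u) rel_family \<Rightarrow> bool" where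
  "order_preserving_family A B \<tau> \<longleftrightarrow> (\<forall>h. \<tau> h \<subseteq> B \<times> A) \<and>
     (\<forall>a\<in>A. \<forall>b\<in>B. \<forall>h k. (b, a) \<in> \<tau> h \<and> k \<le> h \<longrightarrow> (b, a) \<in> \<tau> k)"

definition family_comp ::
    "('h::complete_lattice, 'u) rel_family \<Rightarrow> ('h, 'u) rel_family \<Rightarrow> ('h, 'u) rel_family" where
  "family_comp \<sigma> \<tau> = (\<lambda>h. {(c, a). \<exists>k l. h \<le> inf k l \<and> (c, a) \<in> \<sigma> k O \<tau> l})"

definition family_conv :: "('h, 'u) rel_family \<Rightarrow> ('h, 'u) rel_family" where
  "family_conv \<tau> = (\<lambda>h. (\<tau> h)\<inverse>)"

text \<open>A pair \<open>(X, F)\<close> stands for the relational presheaf \<open>F\<close> with \<open>F(*) = X\<close>.\<close>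

definition relational_presheaf ::
    "'u set \<times> ('h::complete_lattice, 'u) rel_family \<Rightarrow> bool" where
  "relational_presheaf = (\<lambda>(X, F). order_preserving_family X X F \<and>
     family_conv F = F \<and> family_comp F F = F)"

definition relational_presheaf_hom :: "'u set \<times> ('h::complete_lattice, 'u) rel_family
    \<Rightarrow> 'u set \<times> ('h, 'u) rel_family \<Rightarrow> ('h, 'u) rel_family \<Rightarrow> bool" where
  "relational_presheaf_hom = (\<lambda>(X, F) (Y, G) \<theta>. order_preserving_family X Y \<theta> \<and>
     family_comp \<theta> F = \<theta> \<and> family_comp G \<theta> = \<theta> \<and>
     F \<le> family_comp (family_conv \<theta>) \<theta> \<and> family_comp \<theta> (family_conv \<theta>) \<le> G)"

definition relational_presheaf_cat :: "('u set \<Rightarrow> bool)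
    \<Rightarrow> ('u set \<times> ('h::complete_lattice, 'u) rel_family, ('h, 'u) rel_family) cat" where
  "relational_presheaf_cat small = \<lparr>
     Obj = {F. small (fst F) \<and> relational_presheaf F},
     Hom = (\<lambda>F G. {\<theta>. relational_presheaf_hom F G \<theta>}),
     Id = snd,
     Comp = (\<lambda>F G K \<sigma> \<tau>. family_comp \<sigma> \<tau>)\<rparr>"

end

theory Submission imports Defs begin

text \<open>Down-closure makes the composite of order-preserving families pointwise, so a relational
  presheaf is an antitone family of partial equivalence relations \<open>F h\<close> on one set \<open>X\<close>, and a
  morphism is an antitone family of functional relations between them. A presheaf \<open>P\<close> yields such a
  family on the disjoint union of the sets \<open>P h\<close>: two elements are related at \<open>h\<close> iff both live at
  a stage above \<open>h\<close> and have the same restriction to \<open>h\<close>. Restricting everything to stage \<open>h\<close> shows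
  that the construction is fully faithful; it is essentially surjective because \<open>(X, F)\<close> is
  isomorphic to the image of the presheaf of quotients \<open>h \<mapsto> X / F h\<close>.\<close>

section \<open>Equivalences from fully faithful, essentially surjective functors\<close>

text \<open>By choice every \<open>Y\<close> gets an object \<open>g Y\<close> and an isomorphism
  \<open>e Y\<close> from \<open>omap F (g Y)\<close> to \<open>Y\<close>, with inverse
  \<open>e' Y\<close>. The quasi-inverse sends \<open>u\<close> to the unique lift of its conjugate
  by these isomorphisms. Equations in \<open>C\<close> are checked after applying \<open>F\<close>,
  by faithfulness.\<close>

lemma equivalent_categories_if_fully_faithful_eso:
  assumes C: "category C" and D: "category D" and F: "is_functor C D F"
    and ff: "\<And>X Y. \<lbrakk>X \<in> Obj C; Y \<in> Obj C\<rbrakk> \<Longrightarrow>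
      bij_betw (amap F X Y) (Hom C X Y) (Hom D (omap F X) (omap F Y))"
    and eso: "\<And>Y. Y \<in> Obj D \<Longrightarrow> \<exists>X\<in>Obj C. \<exists>f. is_iso D (omap F X) Y f"
  shows "equivalent_categories C D"
proof -
  interpret C: category C by (rule C)
  interpret D: category D by (rule D)
  have FO [simp]: "omap F X \<in> Obj D" if "X \<in> Obj C" for X
    using F that by (simp add: is_functor_def)
  have FH [simp]: "amap F X Y f \<in> Hom D (omap F X) (omap F Y)"
    if "X \<in> Obj C" "Y \<in> Obj C" "f \<in> Hom C X Y" for X Y f
    using F that by (simp add: is_functor_def)
  have FI [simp]: "amap F X X (Id C X) = Id D (omap F X)" if "X \<in> Obj C" for X
    using F that by (simp add: is_functor_def)
  have FC [simp]: "amap F X Z (Comp C X Y Z g f)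
      = Comp D (omap F X) (omap F Y) (omap F Z) (amap F Y Z g) (amap F X Y f)"
    if "X \<in> Obj C" "Y \<in> Obj C" "Z \<in> Obj C" "f \<in> Hom C X Y" "g \<in> Hom C Y Z" for X Y Z f g
    using F that by (simp add: is_functor_def)
  have faithful: "f = f'" if "X \<in> Obj C" "Y \<in> Obj C" "f \<in> Hom C X Y" "f' \<in> Hom C X Y"
    "amap F X Y f = amap F X Y f'" for X Y f f'
    using ff[OF that(1,2)] that(3-) by (meson bij_betw_def inj_onD)
  define lift where "lift X Y = inv_into (Hom C X Y) (amap F X Y)" for X Y
  have lift_Hom [simp]: "lift X Y u \<in> Hom C X Y"
    and F_lift [simp]: "amap F X Y (lift X Y u) = u"
    if "X \<in> Obj C" "Y \<in> Obj C" "u \<in> Hom D (omap F X) (omap F Y)" for X Y u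
    using ff[OF that(1,2)] that(3) unfolding lift_def bij_betw_def
    by (auto simp: inv_into_into f_inv_into_f)
  have "\<forall>Y\<in>Obj D. \<exists>X e e'. X \<in> Obj C \<and> e \<in> Hom D (omap F X) Y \<and> e' \<in> Hom D Y (omap F X)
      \<and> Comp D (omap F X) Y (omap F X) e' e = Id D (omap F X)
      \<and> Comp D Y (omap F X) Y e e' = Id D Y"
    using eso unfolding is_iso_def by blast
  then obtain g e e' where "\<forall>Y\<in>Obj D. g Y \<in> Obj C \<and> e Y \<in> Hom D (omap F (g Y)) Y
      \<and> e' Y \<in> Hom D Y (omap F (g Y))
      \<and> Comp D (omap F (g Y)) Y (omap F (g Y)) (e' Y) (e Y) = Id D (omap F (g Y))
      \<and> Comp D Y (omap F (g Y)) Y (e Y) (e' Y) = Id D Y"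
    by metis
  then have g [simp]: "g Y \<in> Obj C" and e [simp]: "e Y \<in> Hom D (omap F (g Y)) Y"
    and e' [simp]: "e' Y \<in> Hom D Y (omap F (g Y))"
    and e'e [simp]: "Comp D (omap F (g Y)) Y (omap F (g Y)) (e' Y) (e Y) = Id D (omap F (g Y))"
    and ee' [simp]: "Comp D Y (omap F (g Y)) Y (e Y) (e' Y) = Id D Y"
    if "Y \<in> Obj D" for Y
    using that by auto
  note [simp] = C.Id_Hom D.Id_Hom C.Comp_Hom D.Comp_Hom C.Comp_Id_left D.Comp_Id_left
    C.Comp_Id_right D.Comp_Id_right D.Comp_assoc[symmetric]
  \<comment> \<open>The simp set nests composites to the right, so \<open>e Y\<close> and
    \<open>e' Y\<close> may meet in front of a further morphism; this rule cancels them
    there.\<close>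
  have ee'_assoc [simp]: "Comp D X (omap F (g Y)) Y (e Y) (Comp D X Y (omap F (g Y)) (e' Y) u) = u"
    if "X \<in> Obj D" "Y \<in> Obj D" "u \<in> Hom D X Y" for X Y u
    using that by (subst D.Comp_assoc) simp_all
  define G where "G = \<lparr>omap = g, amap = (\<lambda>Y Z u. lift (g Y) (g Z)
      (Comp D (omap F (g Y)) Z (omap F (g Z)) (e' Z) (Comp D (omap F (g Y)) Y Z u (e Y))))\<rparr>"
  have omap_G [simp]: "omap G = g"
    and amap_G [simp]: "amap G Y Z u = lift (g Y) (g Z)
      (Comp D (omap F (g Y)) Z (omap F (g Z)) (e' Z) (Comp D (omap F (g Y)) Y Z u (e Y)))" for Y Z u
    by (simp_all add: G_def)
  have G: "is_functor D C G"
    unfolding is_functor_def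
  proof (intro conjI ballI)
    show "amap G X X (Id D X) = Id C (omap G X)" if "X \<in> Obj D" for X
      by (rule faithful[of "g X" "g X"]) (use that in simp_all)
    show "amap G X Z (Comp D X Y Z v u)
        = Comp C (omap G X) (omap G Y) (omap G Z) (amap G Y Z v) (amap G X Y u)"
      if "X \<in> Obj D" "Y \<in> Obj D" "Z \<in> Obj D" "u \<in> Hom D X Y" "v \<in> Hom D Y Z" for X Y Z u v
      by (rule faithful[of "g X" "g Z"]) (use that in simp_all)
  qed auto
  \<comment> \<open>The unit lifts the inverse of the isomorphism chosen for
    \<open>omap F X\<close>; its own inverse is the lift of \<open>e (omap F X)\<close>. The counit
    is \<open>e\<close> itself.\<close>
  define \<eta> where "\<eta> X = lift X (g (omap F X)) (e' (omap F X))" for X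
  have \<eta>: "is_nat_iso C C id_functor (comp_functor G F) \<eta>"
    unfolding is_nat_iso_def is_nat_trans_def is_iso_def
  proof (intro conjI ballI)
    fix X assume "X \<in> Obj C"
    note [simp] = this
    show "\<exists>h\<in>Hom C (omap (comp_functor G F) X) (omap id_functor X).
        Comp C (omap id_functor X) (omap (comp_functor G F) X) (omap id_functor X) h (\<eta> X)
          = Id C (omap id_functor X) \<and>
        Comp C (omap (comp_functor G F) X) (omap id_functor X) (omap (comp_functor G F) X) (\<eta> X) h
          = Id C (omap (comp_functor G F) X)"
      by (intro bexI[of _ "lift (g (omap F X)) X (e (omap F X))"])
        (simp_all add: id_functor_def comp_functor_def \<eta>_def faithful[of X X]
          faithful[of "g (omap F X)" "g (omap F X)"])
  next
    fix X Y f assume "X \<in> Obj C" "Y \<in> Obj C" "f \<in> Hom C X Y"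
    then show "Comp C (omap id_functor X) (omap id_functor Y) (omap (comp_functor G F) Y) (\<eta> Y)
        (amap id_functor X Y f)
      = Comp C (omap id_functor X) (omap (comp_functor G F) X) (omap (comp_functor G F) Y)
        (amap (comp_functor G F) X Y f) (\<eta> X)"
      by (intro faithful[of X "g (omap F Y)"])
        (simp_all add: id_functor_def comp_functor_def \<eta>_def)
  qed (simp_all add: id_functor_def comp_functor_def \<eta>_def)
  have \<epsilon>: "is_nat_iso D D (comp_functor F G) id_functor e"
    unfolding is_nat_iso_def is_nat_trans_def is_iso_def id_functor_def comp_functor_def
    by (simp, metis e'e ee' e')
  show ?thesis
    unfolding equivalent_categories_def using C D F G \<eta> \<epsilon> by blast
qed

section \<open>Functor categories and the elementwise description of presheaves\<close>

lemma category_functor_cat: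
  assumes "category D"
  shows "category (functor_cat C D)"
proof -
  interpret D: category D by (rule assms)
  show ?thesis
    by standard
      (auto simp: functor_cat_def is_functor_def is_nat_trans_def extensional_def restrict_def
        D.Id_Hom D.Comp_Hom D.Comp_Id_left D.Comp_Id_right fun_eq_iff D.Comp_assoc[symmetric],
       metis D.Comp_assoc)
qed

lemma category_set_cat: "category (set_cat small)"
  by standard (auto simp: set_cat_def compose_def fun_eq_iff PiE_def extensional_def Pi_def)

lemma category_presheaf_cat: "category (presheaf_cat small)"
  unfolding presheaf_cat_def by (rule category_functor_cat[OF category_set_cat])

text \<open>The only possible arrow from \<open>h\<close> to \<open>k\<close> in the opposite poset
  is \<open>()\<close>, present iff \<open>k \<le> h\<close>, so functoriality becomes equations
  between restriction maps. The \<open>undefined\<close> clause is all that extensionality demands,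
  since every element of \<open>'h\<close> is an object.\<close>

lemma Obj_presheaf_cat:
  fixes P :: "('h::order, unit, 'u set, 'u \<Rightarrow> 'u) cfunctor"
  shows "P \<in> Obj (presheaf_cat small) \<longleftrightarrow>
     (\<forall>h. small (omap P h)) \<and>
     (\<forall>h k. k \<le> h \<longrightarrow> amap P h k () \<in> omap P h \<rightarrow>\<^sub>E omap P k) \<and>
     (\<forall>h k. \<not> k \<le> h \<longrightarrow> amap P h k () = undefined) \<and>
     (\<forall>h. \<forall>x\<in>omap P h. amap P h h () x = x) \<and>
     (\<forall>h k l. k \<le> h \<longrightarrow> l \<le> k \<longrightarrow>
       (\<forall>x\<in>omap P h. amap P h l () x = amap P k l () (amap P h k () x)))" (is "_ \<longleftrightarrow> ?R")
proof
  assume P: "P \<in> Obj (presheaf_cat small)"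
  then have F: "is_functor (op_cat poset_cat) (set_cat small) P"
    and E: "functor_extensional (op_cat poset_cat) P"
    by (simp_all add: presheaf_cat_def functor_cat_def)
  note defs = op_cat_def poset_cat_def set_cat_def
  have 1: "\<forall>h\<in>Obj (op_cat poset_cat). omap P h \<in> Obj (set_cat small)"
    and 2: "\<forall>h\<in>Obj (op_cat poset_cat). \<forall>k\<in>Obj (op_cat poset_cat).
      \<forall>f\<in>Hom (op_cat poset_cat) h k. amap P h k f \<in> Hom (set_cat small) (omap P h) (omap P k)"
    and 3: "\<forall>h\<in>Obj (op_cat poset_cat).
      amap P h h (Id (op_cat poset_cat) h) = Id (set_cat small) (omap P h)"
    and 4: "\<forall>h\<in>Obj (op_cat poset_cat). \<forall>k\<in>Obj (op_cat poset_cat). \<forall>l\<in>Obj (op_cat poset_cat).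
      \<forall>f\<in>Hom (op_cat poset_cat) h k. \<forall>g\<in>Hom (op_cat poset_cat) k l.
      amap P h l (Comp (op_cat poset_cat) h k l g f)
        = Comp (set_cat small) (omap P h) (omap P k) (omap P l) (amap P k l g) (amap P h k f)"
    using F unfolding is_functor_def by blast+
  have S: "small (omap P h)" for h
    using 1 by (simp add: defs)
  have R: "amap P h k () \<in> omap P h \<rightarrow>\<^sub>E omap P k" if "k \<le> h" for h k
    using 2 that by (simp add: defs)
  have U: "amap P h k () = undefined" if "\<not> k \<le> h" for h k
    using E that by (simp add: functor_extensional_def op_cat_def poset_cat_def)
  have I: "amap P h h () x = x" if "x \<in> omap P h" for h x
    using 3 that by (simp add: defs)
  have C: "amap P h l () x = amap P k l () (amap P h k () x)"
    if "k \<le> h" "l \<le> k" "x \<in> omap P h" for h k l x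
  proof -
    have "amap P h l () = compose (omap P h) (amap P k l ()) (amap P h k ())"
      using 4[THEN bspec[of _ _ h], THEN bspec[of _ _ k], THEN bspec[of _ _ l],
        THEN bspec[of _ _ "()"], THEN bspec[of _ _ "()"]] that by (simp add: defs)
    then show ?thesis
      by (simp only: compose_eq[OF that(3)])
  qed
  show ?R
    by (intro conjI allI impI ballI S R U I C)
next
  assume P: ?R
  have S: "small (omap P h)" for h
    using P[THEN conjunct1] by blast
  have R: "amap P h k () \<in> omap P h \<rightarrow>\<^sub>E omap P k" if "k \<le> h" for h k
    using P[THEN conjunct2, THEN conjunct1] that by blast
  have U: "amap P h k () = undefined" if "\<not> k \<le> h" for h k
    using P[THEN conjunct2, THEN conjunct2, THEN conjunct1] that by simp
  have I: "amap P h h () x = x" if "x \<in> omap P h" for h x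
    using P[THEN conjunct2, THEN conjunct2, THEN conjunct2, THEN conjunct1] that by simp
  note C = P[THEN conjunct2, THEN conjunct2, THEN conjunct2, THEN conjunct2, rule_format]
  \<comment> \<open>Identities and composites of sets are functions cut off outside their domain, so
    the pointwise laws have to be lifted to equations of extensional functions.\<close>
  have Id: "amap P h h () = (\<lambda>x\<in>omap P h. x)" for h
    by (rule extensionalityI[of _ "omap P h"]) (use R[of h h] I in \<open>simp_all add: PiE_def\<close>)
  have comp: "amap P h l () = compose (omap P h) (amap P k l ()) (amap P h k ())"
    if "k \<le> h" "l \<le> k" for h k l
  proof (rule extensionalityI[of _ "omap P h"])
    show "amap P h l () \<in> extensional (omap P h)"
      using R[of l h] that by (simp add: PiE_def)
    show "amap P h l () x = compose (omap P h) (amap P k l ()) (amap P h k ()) x"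
      if "x \<in> omap P h" for x
      unfolding compose_eq[OF that] by (rule C) fact+
  qed (rule compose_extensional)
  have "is_functor (op_cat poset_cat) (set_cat small) P"
    unfolding is_functor_def
  proof (intro conjI ballI)
    fix h k l :: 'h and f g :: unit
    assume "f \<in> Hom (op_cat poset_cat) h k" "g \<in> Hom (op_cat poset_cat) k l"
    then show "amap P h l (Comp (op_cat poset_cat) h k l g f)
        = Comp (set_cat small) (omap P h) (omap P k) (omap P l) (amap P k l g) (amap P h k f)"
      using comp[of k h l] by (simp add: op_cat_def poset_cat_def set_cat_def split: if_splits)
  qed (use R in \<open>auto simp: op_cat_def poset_cat_def set_cat_def S Id split: if_splits\<close>)
  then show "P \<in> Obj (presheaf_cat small)"
    using U by (simp add: presheaf_cat_def functor_cat_def functor_extensional_def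
      op_cat_def poset_cat_def)
qed

lemma Hom_presheaf_cat:
  assumes "P \<in> Obj (presheaf_cat small)" "Q \<in> Obj (presheaf_cat small)"
  shows "\<eta> \<in> Hom (presheaf_cat small) P Q \<longleftrightarrow>
     (\<forall>h. \<eta> h \<in> omap P h \<rightarrow>\<^sub>E omap Q h) \<and>
     (\<forall>h k. k \<le> h \<longrightarrow> (\<forall>x\<in>omap P h. \<eta> k (amap P h k () x) = amap Q h k () (\<eta> h x)))"
  by (auto simp: presheaf_cat_def functor_cat_def op_cat_def poset_cat_def set_cat_def
    is_nat_trans_def compose_def fun_eq_iff restrict_def)

section \<open>Relational presheaves as antitone families of partial equivalence relations\<close>

lemma order_preserving_family_iff:
  "order_preserving_family A B \<tau> \<longleftrightarrow> (\<forall>h. \<tau> h \<subseteq> B \<times> A) \<and> antimono \<tau>"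
  unfolding order_preserving_family_def antimono_def by blast

text \<open>One inclusion takes \<open>k = l = h\<close>; for the other, antitonicity brings
  \<open>\<sigma> k\<close> and \<open>\<tau> l\<close> down to the common stage \<open>h\<close>.
  Apart from antitonicity itself, conditions on families can then be checked stage by stage.\<close>

lemma family_comp_eq_relcomp:
  assumes "antimono \<sigma>" "antimono \<tau>"
  shows "family_comp \<sigma> \<tau> = (\<lambda>h. \<sigma> h O \<tau> h)"
proof
  fix h
  have "\<sigma> k O \<tau> l \<subseteq> \<sigma> h O \<tau> h" if "h \<le> inf k l" for k l
    using assms that by (intro relcomp_mono antimonoD[of \<sigma>] antimonoD[of \<tau>]) auto
  moreover have "h \<le> inf h h"
    by simp
  ultimately show "family_comp \<sigma> \<tau> h = \<sigma> h O \<tau> h"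
    unfolding family_comp_def by blast
qed

lemma antimono_family_conv: "antimono \<tau> \<Longrightarrow> antimono (family_conv \<tau>)"
  unfolding antimono_def family_conv_def by blast

lemma antimono_relcomp:
  fixes \<sigma> \<tau> :: "('h::order, 'u) rel_family"
  assumes "antimono \<sigma>" "antimono \<tau>"
  shows "antimono (\<lambda>h. \<sigma> h O \<tau> h)"
  by (rule antimonoI, rule relcomp_mono[OF antimonoD[OF assms(1)] antimonoD[OF assms(2)]])

text \<open>For symmetric \<open>R\<close>, transitivity says that \<open>R O R\<close> lies in
  \<open>R\<close>. Conversely, a pair \<open>(x, y)\<close> of a partial equivalence relation
  factors through \<open>(y, y)\<close>. Elements outside the field of \<open>F h\<close> may be
  thought of as not existing at stage \<open>h\<close>.\<close>

lemma relational_presheaf_iff: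
  fixes F :: "('h::complete_lattice, 'u) rel_family"
  shows "relational_presheaf (X, F) \<longleftrightarrow>
     (\<forall>h. F h \<subseteq> X \<times> X) \<and> antimono F \<and> (\<forall>h. sym (F h)) \<and> (\<forall>h. trans (F h))"
proof -
  have conv: "family_conv F = F \<longleftrightarrow> (\<forall>h. sym (F h))"
    by (simp add: family_conv_def fun_eq_iff sym_conv_converse_eq)
  have "R O R = R \<longleftrightarrow> trans R" if "sym R" for R :: "('u \<times> 'u) set"
  proof
    show "R O R = R \<Longrightarrow> trans R"
      by (rule transI) blast
    assume "trans R"
    then show "R O R = R"
      using that by (intro antisym trans_O_subset subrelI) (blast dest: symD transD)+
  qed
  then have "family_comp F F = F \<longleftrightarrow> (\<forall>h. trans (F h))" if "antimono F" "\<forall>h. sym (F h)"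
    using that by (simp add: family_comp_eq_relcomp fun_eq_iff)
  then show ?thesis
    unfolding relational_presheaf_def prod.case order_preserving_family_iff conv by blast
qed

text \<open>The last two inclusions make \<open>\<theta> h\<close> a functional relation: elements
  related by \<open>F h\<close> have a common value, and any two values of one element are related
  by \<open>G h\<close>.\<close>

lemma relational_presheaf_hom_iff:
  assumes "antimono F" "antimono G"
  shows "relational_presheaf_hom (X, F) (Y, G) \<theta> \<longleftrightarrow>
     antimono \<theta> \<and> (\<forall>h. \<theta> h \<subseteq> Y \<times> X) \<and> (\<forall>h. \<theta> h O F h = \<theta> h) \<and> (\<forall>h. G h O \<theta> h = \<theta> h) \<and>
     (\<forall>h. F h \<subseteq> (\<theta> h)\<inverse> O \<theta> h) \<and> (\<forall>h. \<theta> h O (\<theta> h)\<inverse> \<subseteq> G h)"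
proof (cases "antimono \<theta>")
  case True
  then show ?thesis
    using assms antimono_family_conv[OF True]
    by (simp add: relational_presheaf_hom_def order_preserving_family_iff family_comp_eq_relcomp
      fun_eq_iff le_fun_def) (auto simp: family_conv_def)
qed (simp add: relational_presheaf_hom_def order_preserving_family_iff)

lemma category_relational_presheaf_cat:
  "category (relational_presheaf_cat small
    :: ('a set \<times> ('b::complete_lattice, 'a) rel_family, ('b, 'a) rel_family) cat)"
proof -
  note defs = relational_presheaf_cat_def relational_presheaf_iff relational_presheaf_hom_iff
  show ?thesis
  proof
    fix F :: "'a set \<times> ('b, 'a) rel_family"
    assume "F \<in> Obj (relational_presheaf_cat small)"
    moreover obtain X F' where [simp]: "F = (X, F')"
      by fastforce
    ultimately have F': "relational_presheaf (X, F')"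
      by (simp add: relational_presheaf_cat_def)
    then have "family_conv F' = F'" "family_comp F' F' = F'" "order_preserving_family X X F'"
      by (simp_all add: relational_presheaf_def)
    then show "Id (relational_presheaf_cat small) F \<in> Hom (relational_presheaf_cat small) F F"
      by (simp add: relational_presheaf_cat_def relational_presheaf_hom_def)
  next
    fix F G K :: "'a set \<times> ('b, 'a) rel_family" and \<theta> \<sigma>
    assume "F \<in> Obj (relational_presheaf_cat small)" "G \<in> Obj (relational_presheaf_cat small)"
      "K \<in> Obj (relational_presheaf_cat small)" "\<theta> \<in> Hom (relational_presheaf_cat small) F G"
      "\<sigma> \<in> Hom (relational_presheaf_cat small) G K"
    moreover obtain X F' Y G' Z K' where [simp]: "F = (X, F')" "G = (Y, G')" "K = (Z, K')"
      by (metis surj_pair)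
    ultimately have
      am: "antimono F'" "antimono G'" "antimono K'" "antimono \<theta>" "antimono \<sigma>" and
      \<theta>: "\<And>h. \<theta> h \<subseteq> Y \<times> X" "\<And>h. \<theta> h O F' h = \<theta> h" "\<And>h. G' h O \<theta> h = \<theta> h"
         "\<And>h. F' h \<subseteq> (\<theta> h)\<inverse> O \<theta> h" "\<And>h. \<theta> h O (\<theta> h)\<inverse> \<subseteq> G' h" and
      \<sigma>: "\<And>h. \<sigma> h \<subseteq> Z \<times> Y" "\<And>h. \<sigma> h O G' h = \<sigma> h" "\<And>h. K' h O \<sigma> h = \<sigma> h"
         "\<And>h. G' h \<subseteq> (\<sigma> h)\<inverse> O \<sigma> h" "\<And>h. \<sigma> h O (\<sigma> h)\<inverse> \<subseteq> K' h"
      by (auto simp: defs)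
    \<comment> \<open>\<open>G' h\<close> is inserted next to \<open>\<theta> h\<close>, which
      absorbs it, and then enlarged by totality of \<open>\<sigma>\<close>. The second bound goes
      the other way: single-valuedness of \<open>\<theta>\<close> produces \<open>G' h\<close>,
      which \<open>\<sigma> h\<close> absorbs.\<close>
    have "F' h \<subseteq> (\<sigma> h O \<theta> h)\<inverse> O (\<sigma> h O \<theta> h)" for h
    proof -
      have "F' h \<subseteq> (\<theta> h)\<inverse> O (G' h O \<theta> h)"
        using \<theta> by simp
      also have "\<dots> \<subseteq> (\<theta> h)\<inverse> O (((\<sigma> h)\<inverse> O \<sigma> h) O \<theta> h)"
        by (intro relcomp_mono order_refl \<sigma>)
      finally show ?thesis
        by (simp add: converse_relcomp O_assoc)
    qed
    moreover have "(\<sigma> h O \<theta> h) O (\<sigma> h O \<theta> h)\<inverse> \<subseteq> K' h" for h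
    proof -
      have "(\<sigma> h O \<theta> h) O (\<sigma> h O \<theta> h)\<inverse> = (\<sigma> h O (\<theta> h O (\<theta> h)\<inverse>)) O (\<sigma> h)\<inverse>"
        by (simp add: converse_relcomp O_assoc)
      also have "\<dots> \<subseteq> (\<sigma> h O G' h) O (\<sigma> h)\<inverse>"
        by (intro relcomp_mono order_refl \<theta>)
      also have "\<dots> \<subseteq> K' h"
        using \<sigma> by simp
      finally show ?thesis .
    qed
    moreover have "\<sigma> h O \<theta> h \<subseteq> Z \<times> X" for h
      using \<theta>(1)[of h] \<sigma>(1)[of h] by blast
    moreover have "(\<sigma> h O \<theta> h) O F' h = \<sigma> h O \<theta> h" for h
      using \<theta>(2) by (simp add: O_assoc)
    moreover have "K' h O (\<sigma> h O \<theta> h) = \<sigma> h O \<theta> h" for h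
      using \<sigma>(3) by (simp add: O_assoc[symmetric])
    ultimately show "Comp (relational_presheaf_cat small) F G K \<sigma> \<theta>
        \<in> Hom (relational_presheaf_cat small) F K"
      using am antimono_relcomp[of \<sigma> \<theta>] by (simp add: defs family_comp_eq_relcomp)
  next
    fix W X Y Z and f g h :: "('b, 'a) rel_family"
    assume "f \<in> Hom (relational_presheaf_cat small) W X" "g \<in> Hom (relational_presheaf_cat small) X Y"
      "h \<in> Hom (relational_presheaf_cat small) Y Z"
    then have "antimono f" "antimono g" "antimono h"
      by (auto simp: relational_presheaf_cat_def relational_presheaf_hom_def
        order_preserving_family_iff split: prod.splits)
    then show "Comp (relational_presheaf_cat small) W Y Z h
        (Comp (relational_presheaf_cat small) W X Y g f)
      = Comp (relational_presheaf_cat small) W X Z (Comp (relational_presheaf_cat small) X Y Z h g) f"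
      by (simp add: relational_presheaf_cat_def family_comp_eq_relcomp antimono_relcomp O_assoc)
  qed (auto simp: relational_presheaf_cat_def relational_presheaf_hom_def)
qed

text \<open>The inverse is the converse family. The extra inclusions say that
  \<open>\<theta>\<close> is injective up to \<open>F\<close> and surjective up to \<open>G\<close>;
  with the bounds contained in a morphism they become equalities, which are the two inverse
  laws.\<close>

lemma is_iso_relational_presheaf_cat:
  assumes F: "relational_presheaf (X, F)" and G: "relational_presheaf (Y, G)"
    and \<theta>: "relational_presheaf_hom (X, F) (Y, G) \<theta>"
    and eq: "\<And>h. (\<theta> h)\<inverse> O \<theta> h \<subseteq> F h" "\<And>h. G h \<subseteq> \<theta> h O (\<theta> h)\<inverse>"
  shows "is_iso (relational_presheaf_cat small) (X, F) (Y, G) \<theta>"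
proof -
  note * = F[unfolded relational_presheaf_iff] G[unfolded relational_presheaf_iff]
  have \<theta>': "antimono \<theta>" "\<And>h. \<theta> h \<subseteq> Y \<times> X" "\<And>h. \<theta> h O F h = \<theta> h" "\<And>h. G h O \<theta> h = \<theta> h"
      "\<And>h. F h \<subseteq> (\<theta> h)\<inverse> O \<theta> h" "\<And>h. \<theta> h O (\<theta> h)\<inverse> \<subseteq> G h"
    using \<theta> * by (simp_all add: relational_presheaf_hom_iff)
  have eqs: "(\<theta> h)\<inverse> O \<theta> h = F h" "\<theta> h O (\<theta> h)\<inverse> = G h" for h
    by (rule subset_antisym[OF eq(1) \<theta>'(5)], rule subset_antisym[OF \<theta>'(6) eq(2)])
  have conv: "(F h)\<inverse> = F h" "(G h)\<inverse> = G h" for h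
    using * by (auto simp: sym_conv_converse_eq)
  have "F h O (\<theta> h)\<inverse> = (\<theta> h)\<inverse>" "(\<theta> h)\<inverse> O G h = (\<theta> h)\<inverse>" for h
    using \<theta>'(3,4)[of h] conv[of h] by (metis converse_relcomp)+
  moreover have conv_sub: "(\<theta> h)\<inverse> \<subseteq> X \<times> Y" for h
    using \<theta>'(2)[of h] by blast
  ultimately have "relational_presheaf_hom (Y, G) (X, F) (family_conv \<theta>)"
    using * \<theta>'(1) eqs conv_sub antimono_family_conv[of \<theta>]
    by (simp add: relational_presheaf_hom_iff family_conv_def)
  moreover have "family_comp (family_conv \<theta>) \<theta> = F" "family_comp \<theta> (family_conv \<theta>) = G"
    using * \<theta>' eqs antimono_family_conv[of \<theta>]
    by (simp_all add: family_comp_eq_relcomp family_conv_def)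
  ultimately show ?thesis
    using \<theta> by (auto simp: is_iso_def relational_presheaf_cat_def)
qed

section \<open>The relational presheaf of elements of a presheaf\<close>

text \<open>The injective tagging places the disjoint union of the values of a presheaf inside
  \<open>'u\<close>, and \<open>small_tagged\<close> keeps that union small.\<close>

locale tagged_universe = set_universe small
  for small :: "'u set \<Rightarrow> bool" +
  fixes tag :: "'h::complete_lattice \<Rightarrow> 'u \<Rightarrow> 'u"
  assumes tag_inject [simp]: "tag h x = tag k y \<longleftrightarrow> h = k \<and> x = y"
    and small_tagged: "(\<And>h. small (A h)) \<Longrightarrow> small (\<Union>h. tag h ` A h)"
begin

abbreviation "Psh \<equiv> presheaf_cat small :: (('h, unit, 'u set, 'u \<Rightarrow> 'u) cfunctor, 'h \<Rightarrow> 'u \<Rightarrow> 'u) cat"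
abbreviation "Rel \<equiv> relational_presheaf_cat small
  :: ('u set \<times> ('h, 'u) rel_family, ('h, 'u) rel_family) cat"

definition elements :: "('h, unit, 'u set, 'u \<Rightarrow> 'u) cfunctor \<Rightarrow> 'u set" where
  "elements P = (\<Union>h. tag h ` omap P h)"

text \<open>Elements of different stages are compared after restriction to \<open>h\<close>. For the
  identity transformation this is equality of restrictions, the partial equivalence relation
  attached to \<open>P\<close>.\<close>

definition graph where
  "graph P Q \<eta> h = {(tag l y, tag k x) | k l x y. x \<in> omap P k \<and> y \<in> omap Q l \<and> h \<le> k \<and> h \<le> l
     \<and> \<eta> h (amap P k h () x) = amap Q l h () y}"

text \<open>With the graph of the identity as object part, preservation of identities holds by
  definition.\<close>

definition rel_of where
  "rel_of = \<lparr>omap = (\<lambda>P. (elements P, graph P P (Id Psh P))), amap = graph\<rparr>"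

lemma Id_Psh: "Id Psh P h = (\<lambda>x\<in>omap P h. x)"
  by (simp add: presheaf_cat_def functor_cat_def op_cat_def poset_cat_def set_cat_def)

lemma Comp_Psh: "Comp Psh P Q R \<kappa> \<eta> h = compose (omap P h) (\<kappa> h) (\<eta> h)"
  by (simp add: presheaf_cat_def functor_cat_def op_cat_def poset_cat_def set_cat_def)

lemma restriction:
  assumes "P \<in> Obj Psh"
  shows restriction_in: "\<lbrakk>k \<le> h; x \<in> omap P h\<rbrakk> \<Longrightarrow> amap P h k () x \<in> omap P k"
    and restriction_self: "x \<in> omap P h \<Longrightarrow> amap P h h () x = x"
    and restriction_restriction: "\<lbrakk>k \<le> h; l \<le> k; x \<in> omap P h\<rbrakk>
      \<Longrightarrow> amap P k l () (amap P h k () x) = amap P h l () x"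
proof -
  note P = assms[unfolded Obj_presheaf_cat, THEN conjunct2]
  show "amap P h k () x \<in> omap P k" if "k \<le> h" "x \<in> omap P h"
    using P[THEN conjunct1] that by blast
  show "amap P h h () x = x" if "x \<in> omap P h"
    using P[THEN conjunct2, THEN conjunct2, THEN conjunct1] that by blast
  show "amap P k l () (amap P h k () x) = amap P h l () x" if "k \<le> h" "l \<le> k" "x \<in> omap P h"
    by (rule P[THEN conjunct2, THEN conjunct2, THEN conjunct2, rule_format, symmetric]) fact+
qed

lemma nat_trans:
  assumes "P \<in> Obj Psh" "Q \<in> Obj Psh" "\<eta> \<in> Hom Psh P Q"
  shows nat_trans_in: "x \<in> omap P h \<Longrightarrow> \<eta> h x \<in> omap Q h"
    and nat_trans_restriction: "\<lbrakk>k \<le> h; x \<in> omap P h\<rbrakk>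
      \<Longrightarrow> \<eta> k (amap P h k () x) = amap Q h k () (\<eta> h x)"
  using assms by (auto simp: Hom_presheaf_cat)

section \<open>Functoriality of graphs\<close>

lemma graph_subset: "graph P Q \<eta> h \<subseteq> elements Q \<times> elements P"
  by (auto simp: graph_def elements_def)

text \<open>Naturality carries an equation between values at stage \<open>h\<close> to the smaller
  stage \<open>k\<close>.\<close>

lemma antimono_graph:
  assumes P: "P \<in> Obj Psh" and Q: "Q \<in> Obj Psh" and \<eta>: "\<eta> \<in> Hom Psh P Q"
  shows "antimono (graph P Q \<eta>)"
proof (rule antimonoI)
  fix h k :: 'h assume "k \<le> h"
  have "\<eta> k (amap P m k () x) = amap Q l k () y"
    if "h \<le> m" "h \<le> l" "x \<in> omap P m" "y \<in> omap Q l" "\<eta> h (amap P m h () x) = amap Q l h () y"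
    for l m x y
  proof -
    have "\<eta> k (amap P m k () x) = amap Q h k () (\<eta> h (amap P m h () x))"
      using that \<open>k \<le> h\<close> restriction[OF P] nat_trans[OF assms] by metis
    then show ?thesis
      using that \<open>k \<le> h\<close> restriction[OF Q] by simp
  qed
  then show "graph P Q \<eta> h \<subseteq> graph P Q \<eta> k"
    using \<open>k \<le> h\<close> by (fastforce simp: graph_def intro: order_trans)
qed

text \<open>A pair of the composite factors through the value of \<open>\<eta> h\<close> at the
  restricted element. That value lives at stage \<open>h\<close> itself and therefore carries the
  tag \<open>h\<close>.\<close>

lemma graph_comp:
  assumes P: "P \<in> Obj Psh" and Q: "Q \<in> Obj Psh" and R: "R \<in> Obj Psh"
    and \<eta>: "\<eta> \<in> Hom Psh P Q" and \<kappa>: "\<kappa> \<in> Hom Psh Q R"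
  shows "graph P R (Comp Psh P Q R \<kappa> \<eta>) h = graph Q R \<kappa> h O graph P Q \<eta> h"
proof
  show "graph P R (Comp Psh P Q R \<kappa> \<eta>) h \<subseteq> graph Q R \<kappa> h O graph P Q \<eta> h"
  proof
    fix p assume "p \<in> graph P R (Comp Psh P Q R \<kappa> \<eta>) h"
    then obtain k l x z where p: "p = (tag l z, tag k x)" "x \<in> omap P k" "z \<in> omap R l"
      "h \<le> k" "h \<le> l" "\<kappa> h (\<eta> h (amap P k h () x)) = amap R l h () z"
      using restriction_in[OF P] by (fastforce simp: graph_def Comp_Psh compose_def)
    define y where "y = \<eta> h (amap P k h () x)"
    have "y \<in> omap Q h"
      unfolding y_def using p by (intro nat_trans_in[OF P Q \<eta>] restriction_in[OF P])
    then have "(tag h y, tag k x) \<in> graph P Q \<eta> h" "(tag l z, tag h y) \<in> graph Q R \<kappa> h"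
      using p restriction_self[OF Q] by (auto simp: graph_def y_def)
    then show "p \<in> graph Q R \<kappa> h O graph P Q \<eta> h"
      using p by blast
  qed
  show "graph Q R \<kappa> h O graph P Q \<eta> h \<subseteq> graph P R (Comp Psh P Q R \<kappa> \<eta>) h"
    using restriction_in[OF P] by (fastforce simp: graph_def Comp_Psh compose_def)
qed

lemma graph_Id:
  assumes "P \<in> Obj Psh"
  shows "graph P P (Id Psh P) h = {(tag l y, tag k x) | k l x y. x \<in> omap P k \<and> y \<in> omap P l \<and>
    h \<le> k \<and> h \<le> l \<and> amap P k h () x = amap P l h () y}"
  using restriction_in[OF assms] by (fastforce simp: graph_def Id_Psh)

lemma Id_Psh_Hom: "P \<in> Obj Psh \<Longrightarrow> Id Psh P \<in> Hom Psh P P"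
  by (rule category.Id_Hom[OF category_presheaf_cat])

lemma relational_presheaf_elements:
  assumes P: "P \<in> Obj Psh"
  shows "relational_presheaf (elements P, graph P P (Id Psh P))"
  unfolding relational_presheaf_iff
  by (intro conjI allI graph_subset antimono_graph[OF P P Id_Psh_Hom[OF P]])
    (auto simp: graph_Id[OF P] intro!: symI transI)

lemma rel_of_Obj:
  assumes P: "P \<in> Obj Psh"
  shows "(elements P, graph P P (Id Psh P)) \<in> Obj Rel"
  using relational_presheaf_elements[OF P] small_tagged[of "omap P"]
    P[unfolded Obj_presheaf_cat, THEN conjunct1]
  by (simp add: relational_presheaf_cat_def elements_def)

text \<open>Absorption of the identities is an instance of \<open>graph_comp\<close>. For totality,
  elements with equal restrictions to \<open>h\<close> share the value of \<open>\<eta> h\<close>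
  there, tagged with \<open>h\<close>.\<close>

lemma relational_presheaf_hom_graph:
  assumes P: "P \<in> Obj Psh" and Q: "Q \<in> Obj Psh" and \<eta>: "\<eta> \<in> Hom Psh P Q"
  shows "relational_presheaf_hom (elements P, graph P P (Id Psh P))
    (elements Q, graph Q Q (Id Psh Q)) (graph P Q \<eta>)"
proof -
  interpret Psh: category Psh by (rule category_presheaf_cat)
  have "graph P Q \<eta> h O graph P P (Id Psh P) h = graph P Q \<eta> h"
    "graph Q Q (Id Psh Q) h O graph P Q \<eta> h = graph P Q \<eta> h" for h
    using assms by (simp_all add: graph_comp[symmetric] Psh.Id_Hom Psh.Comp_Id_left
      Psh.Comp_Id_right)
  moreover have "graph P P (Id Psh P) h \<subseteq> (graph P Q \<eta> h)\<inverse> O graph P Q \<eta> h" for h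
  proof
    fix p assume "p \<in> graph P P (Id Psh P) h"
    then obtain k l x y where p: "p = (tag l y, tag k x)" "x \<in> omap P k" "y \<in> omap P l"
      "h \<le> k" "h \<le> l" "amap P k h () x = amap P l h () y"
      by (auto simp: graph_Id[OF P])
    define z where "z = \<eta> h (amap P k h () x)"
    have "z \<in> omap Q h"
      unfolding z_def using p by (intro nat_trans_in[OF assms] restriction_in[OF P])
    then have "(tag h z, tag k x) \<in> graph P Q \<eta> h" "(tag h z, tag l y) \<in> graph P Q \<eta> h"
      using p restriction_self[OF Q] by (auto simp: graph_def z_def)
    then show "p \<in> (graph P Q \<eta> h)\<inverse> O graph P Q \<eta> h"
      using p by blast
  qed
  moreover have "graph P Q \<eta> h O (graph P Q \<eta> h)\<inverse> \<subseteq> graph Q Q (Id Psh Q) h" for h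
    by (auto simp: graph_Id[OF Q]) (auto simp: graph_def)
  ultimately show ?thesis
    using antimono_graph assms Id_Psh_Hom graph_subset by (simp add: relational_presheaf_hom_iff)
qed

lemma is_functor_rel_of: "is_functor Psh Rel rel_of"
  using rel_of_Obj relational_presheaf_hom_graph antimono_graph graph_comp
  by (auto simp: is_functor_def rel_of_def family_comp_eq_relcomp relational_presheaf_cat_def
    fun_eq_iff)

section \<open>Full faithfulness\<close>

text \<open>Restriction from \<open>h\<close> to itself is the identity, so the pairs with both tags
  equal to \<open>h\<close> recover the function \<open>\<eta> h\<close>. Faithfulness
  follows.\<close>

lemma graph_tag_iff:
  assumes P: "P \<in> Obj Psh" and Q: "Q \<in> Obj Psh" and \<eta>: "\<eta> \<in> Hom Psh P Q"
  shows "(tag h y, tag h x) \<in> graph P Q \<eta> h \<longleftrightarrow> x \<in> omap P h \<and> y \<in> omap Q h \<and> \<eta> h x = y"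
  using restriction_self[OF P] restriction_self[OF Q] by (auto simp: graph_def)

lemma graph_inj:
  assumes P: "P \<in> Obj Psh" and Q: "Q \<in> Obj Psh" and \<eta>: "\<eta> \<in> Hom Psh P Q"
    and \<eta>': "\<eta>' \<in> Hom Psh P Q" and eq: "graph P Q \<eta> = graph P Q \<eta>'"
  shows "\<eta> = \<eta>'"
proof
  fix h
  have "\<eta> h \<in> omap P h \<rightarrow>\<^sub>E omap Q h" "\<eta>' h \<in> omap P h \<rightarrow>\<^sub>E omap Q h"
    using assms by (auto simp: Hom_presheaf_cat)
  then show "\<eta> h = \<eta>' h"
  proof (rule PiE_ext)
    fix x assume "x \<in> omap P h"
    then show "\<eta> h x = \<eta>' h x"
      using graph_tag_iff[OF P Q \<eta>, of h "\<eta> h x" x] graph_tag_iff[OF P Q \<eta>', of h "\<eta> h x" x]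
        nat_trans_in[OF P Q \<eta>] eq by simp
  qed
qed

text \<open>At stage \<open>h\<close> every element is identified with its restriction to
  \<open>h\<close>, so \<open>\<theta> h\<close> is determined by its pairs with both tags
  \<open>h\<close>. These form the graph of a function by totality and single-valuedness, and the
  functions assemble to \<open>\<eta>\<close>.\<close>

lemma graph_surj:
  assumes P: "P \<in> Obj Psh" and Q: "Q \<in> Obj Psh"
    and \<theta>: "relational_presheaf_hom (elements P, graph P P (Id Psh P))
      (elements Q, graph Q Q (Id Psh Q)) \<theta>"
  shows "\<exists>\<eta>\<in>Hom Psh P Q. graph P Q \<eta> = \<theta>"
proof -
  have am: "antimono \<theta>" and sub: "\<And>h. \<theta> h \<subseteq> elements Q \<times> elements P"
    and \<theta>P: "\<And>h. \<theta> h O graph P P (Id Psh P) h = \<theta> h"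
    and Q\<theta>: "\<And>h. graph Q Q (Id Psh Q) h O \<theta> h = \<theta> h"
    and total: "\<And>h. graph P P (Id Psh P) h \<subseteq> (\<theta> h)\<inverse> O \<theta> h"
    and single: "\<And>h. \<theta> h O (\<theta> h)\<inverse> \<subseteq> graph Q Q (Id Psh Q) h"
    using \<theta> antimono_graph[OF P P Id_Psh_Hom[OF P]] antimono_graph[OF Q Q Id_Psh_Hom[OF Q]]
    by (simp_all add: relational_presheaf_hom_iff)
  have P_rel: "(tag l y, tag k x) \<in> graph P P (Id Psh P) h \<longleftrightarrow> x \<in> omap P k \<and> y \<in> omap P l \<and>
    h \<le> k \<and> h \<le> l \<and> amap P k h () x = amap P l h () y" for h k l x y
    by (auto simp: graph_Id[OF P])
  have Q_rel: "(tag l y, tag k x) \<in> graph Q Q (Id Psh Q) h \<longleftrightarrow> x \<in> omap Q k \<and> y \<in> omap Q l \<and>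
    h \<le> k \<and> h \<le> l \<and> amap Q k h () x = amap Q l h () y" for h k l x y
    by (auto simp: graph_Id[OF Q])
  \<comment> \<open>Absorbing both identity graphs forces the entries to be tagged elements of
    stages above \<open>h\<close>.\<close>
  have \<theta>_cases: "\<exists>k l x y. p = (tag l y, tag k x) \<and> x \<in> omap P k \<and> y \<in> omap Q l \<and> h \<le> k \<and> h \<le> l"
    if "p \<in> \<theta> h" for p h
  proof -
    have "p \<in> graph Q Q (Id Psh Q) h O \<theta> h O graph P P (Id Psh P) h"
      using that \<theta>P Q\<theta> by simp
    then show ?thesis
      by (auto simp: graph_Id[OF P] graph_Id[OF Q])
  qed
  \<comment> \<open>Each element is related at \<open>h\<close> to its own restriction, in both
    directions, and \<open>\<theta> h\<close> absorbs these pairs on either side.\<close>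
  have \<theta>_restrict: "(tag l y, tag k x) \<in> \<theta> h \<longleftrightarrow> (tag h (amap Q l h () y), tag h (amap P k h () x)) \<in> \<theta> h"
    if "x \<in> omap P k" "y \<in> omap Q l" "h \<le> k" "h \<le> l" for h k l x y
  proof -
    define x' y' where "x' = amap P k h () x" and "y' = amap Q l h () y"
    have "(tag k x, tag h x') \<in> graph P P (Id Psh P) h" "(tag h x', tag k x) \<in> graph P P (Id Psh P) h"
      "(tag l y, tag h y') \<in> graph Q Q (Id Psh Q) h" "(tag h y', tag l y) \<in> graph Q Q (Id Psh Q) h"
      using that by (simp_all add: P_rel Q_rel x'_def y'_def restriction[OF P] restriction[OF Q])
    then have "(tag l y, tag k x) \<in> \<theta> h \<longleftrightarrow> (tag h y', tag h x') \<in> \<theta> h"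
      using \<theta>P[of h] Q\<theta>[of h] by blast
    then show ?thesis
      by (simp add: x'_def y'_def)
  qed
  have unique: "y = y'" if "(tag h y, b) \<in> \<theta> h" "(tag h y', b) \<in> \<theta> h" for h y y' b
  proof -
    have "(tag h y, tag h y') \<in> graph Q Q (Id Psh Q) h"
      using single that by blast
    then show ?thesis
      by (auto simp: Q_rel restriction_self[OF Q])
  qed
  \<comment> \<open>Totality at the reflexive pair of \<open>tag h x\<close> yields a value at some
    stage above \<open>h\<close>, which is then restricted to \<open>h\<close>.\<close>
  have ex: "\<exists>y\<in>omap Q h. (tag h y, tag h x) \<in> \<theta> h" if x: "x \<in> omap P h" for h x
  proof -
    have "(tag h x, tag h x) \<in> graph P P (Id Psh P) h"
      using x by (simp add: P_rel)
    then obtain b where b: "(b, tag h x) \<in> \<theta> h"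
      using total by blast
    then obtain l z where "b = tag l z" "z \<in> omap Q l" "h \<le> l"
      using \<theta>_cases by blast
    then show ?thesis
      using \<theta>_restrict[OF x, of z l h] b x
      by (auto simp: restriction[OF P] restriction_in[OF Q])
  qed
  define \<eta> where "\<eta> h = (\<lambda>x\<in>omap P h. THE y. (tag h y, tag h x) \<in> \<theta> h)" for h
  have \<eta>_eq: "\<eta> h x = y" if "x \<in> omap P h" "(tag h y, tag h x) \<in> \<theta> h" for h x y
    using that unique by (auto simp: \<eta>_def)
  have \<eta>_in: "\<eta> h x \<in> omap Q h" and \<eta>_\<theta>: "(tag h (\<eta> h x), tag h x) \<in> \<theta> h"
    if "x \<in> omap P h" for h x
    using ex[OF that] \<eta>_eq[OF that] by auto
  \<comment> \<open>Naturality: antitonicity moves the pair for \<open>x\<close> from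
    \<open>\<theta> h\<close> to \<open>\<theta> k\<close>, restricting both entries to
    \<open>k\<close> keeps it there, and uniqueness of values concludes.\<close>
  have "\<eta> k (amap P h k () x) = amap Q h k () (\<eta> h x)" if "k \<le> h" "x \<in> omap P h" for h k x
  proof (rule \<eta>_eq)
    have "(tag h (\<eta> h x), tag h x) \<in> \<theta> k"
      using antimonoD[OF am that(1)] \<eta>_\<theta>[OF that(2)] by blast
    then show "(tag k (amap Q h k () (\<eta> h x)), tag k (amap P h k () x)) \<in> \<theta> k"
      using \<theta>_restrict that \<eta>_in by blast
  qed (use restriction_in[OF P] that in blast)
  then have "\<eta> \<in> Hom Psh P Q"
    using \<eta>_in by (auto simp: Hom_presheaf_cat[OF P Q]) (auto simp: \<eta>_def)
  moreover have "graph P Q \<eta> = \<theta>"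
  proof
    fix h
    have *: "(tag l y, tag k x) \<in> \<theta> h \<longleftrightarrow> \<eta> h (amap P k h () x) = amap Q l h () y"
      if "x \<in> omap P k" "y \<in> omap Q l" "h \<le> k" "h \<le> l" for k l x y
      using \<theta>_restrict[OF that] \<eta>_eq \<eta>_\<theta> restriction_in[OF P that(3,1)] by metis
    show "graph P Q \<eta> h = \<theta> h"
    proof (intro antisym subsetI)
      fix p assume "p \<in> graph P Q \<eta> h"
      then obtain k l x y where "p = (tag l y, tag k x)" "x \<in> omap P k" "y \<in> omap Q l" "h \<le> k"
        "h \<le> l" "\<eta> h (amap P k h () x) = amap Q l h () y"
        unfolding graph_def by blast
      then show "p \<in> \<theta> h"
        using * by simp
    next
      fix p assume p: "p \<in> \<theta> h"
      then obtain k l x y where "p = (tag l y, tag k x)" "x \<in> omap P k" "y \<in> omap Q l" "h \<le> k"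
        "h \<le> l"
        using \<theta>_cases by blast
      then show "p \<in> graph P Q \<eta> h"
        using * p unfolding graph_def by blast
    qed
  qed
  ultimately show ?thesis
    by blast
qed

lemma fully_faithful_rel_of:
  assumes "P \<in> Obj Psh" "Q \<in> Obj Psh"
  shows "bij_betw (amap rel_of P Q) (Hom Psh P Q) (Hom Rel (omap rel_of P) (omap rel_of Q))"
  unfolding bij_betw_def inj_on_def
  using graph_inj[OF assms] relational_presheaf_hom_graph[OF assms] graph_surj[OF assms]
  by (auto simp: rel_of_def relational_presheaf_cat_def image_iff) metis

section \<open>Essential surjectivity\<close>

text \<open>For \<open>k \<le> h\<close> antitonicity puts \<open>F h\<close> inside
  \<open>F k\<close>, so each class at \<open>h\<close> lies in a unique class at \<open>k\<close>;
  this makes the quotients a presheaf. The isomorphism links an element of \<open>X\<close> to its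
  classes.\<close>

lemma essentially_surjective_rel_of:
  assumes "XF \<in> Obj Rel"
  shows "\<exists>P\<in>Obj Psh. \<exists>\<theta>. is_iso Rel (omap rel_of P) XF \<theta>"
proof -
  obtain X F where XF: "XF = (X, F)"
    by (cases XF)
  have small: "small X" and F: "relational_presheaf (X, F)"
    using assms by (auto simp: XF relational_presheaf_cat_def)
  then have sub: "\<And>h. F h \<subseteq> X \<times> X" and am: "antimono F"
    and sym: "\<And>h x y. (x, y) \<in> F h \<Longrightarrow> (y, x) \<in> F h"
    and trans: "\<And>h x y z. (x, y) \<in> F h \<Longrightarrow> (y, z) \<in> F h \<Longrightarrow> (x, z) \<in> F h"
    by (auto simp: relational_presheaf_iff dest: symD transD)
  have down: "(x, y) \<in> F k" if "k \<le> h" "(x, y) \<in> F h" for h k x y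
    using antimonoD[OF am that(1)] that(2) by blast
  \<comment> \<open>Presheaf values must be small sets of elements of \<open>'u\<close>, so classes are replaced by chosen
    representatives.\<close>
  define rep where "rep h x = (SOME y. (y, x) \<in> F h)" for h x
  have rep: "(rep h x, x) \<in> F h" if "(y, x) \<in> F h" for h x y
    unfolding rep_def using that by (rule someI)
  have rep_eq: "rep h x = rep h y" if "(x, y) \<in> F h" for h x y
    unfolding rep_def by (rule arg_cong[where f = Eps]) (use that sym trans in blast)
  \<comment> \<open>One representative for each class of \<open>F h\<close> on its field;
    \<open>A h\<close> plays the role of the quotient.\<close>
  define A where "A h = {x. (x, x) \<in> F h \<and> rep h x = x}" for h
  have rep_A: "rep h x \<in> A h" if "(y, x) \<in> F h" for h x y
    using rep[OF that] rep_eq[of "rep h x" x h] sym trans unfolding A_def by blast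
  have A_iff: "x \<in> A h \<longleftrightarrow> (x, x) \<in> F h \<and> rep h x = x" for h x
    by (simp add: A_def)
  define P :: "('h, unit, 'u set, 'u \<Rightarrow> 'u) cfunctor" where
    "P = \<lparr>omap = A, amap = (\<lambda>h k _. if k \<le> h then restrict (rep k) (A h) else undefined)\<rparr>"
  have [simp]: "omap P = A"
    and [simp]: "amap P h k u = (if k \<le> h then restrict (rep k) (A h) else undefined)" for h k u
    by (simp_all add: P_def)
  have rep_A_mono: "rep k x \<in> A k" if "k \<le> h" "x \<in> A h" for h k x
    using that rep_A down A_iff by blast
  \<comment> \<open>Functoriality of restriction: \<open>rep k x\<close> and \<open>x\<close> are
    related at \<open>k\<close>, hence at \<open>l\<close>, and so have the same representative
    there.\<close>
  have rep_rep: "rep l (rep k x) = rep l x" if "k \<le> h" "l \<le> k" "x \<in> A h" for h k l x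
    using that rep[of x x k] rep_eq[of "rep k x" x l] down A_iff by blast
  have small_A: "small (A h)" for h
    using sub by (intro small_subset[OF small]) (auto simp: A_def)
  have P: "P \<in> Obj Psh"
    unfolding Obj_presheaf_cat
  proof (intro conjI allI impI ballI)
    fix h k l :: 'h and x
    show "small (omap P h)"
      using small_A by simp
    show "amap P h k () \<in> omap P h \<rightarrow>\<^sub>E omap P k" if "k \<le> h"
      using that rep_A_mono[OF that] by auto
    show "amap P h k () = undefined" if "\<not> k \<le> h"
      using that by simp
    show "amap P h h () x = x" if "x \<in> omap P h"
      using that A_iff by simp
    show "amap P h l () x = amap P k l () (amap P h k () x)"
      if "k \<le> h" "l \<le> k" "x \<in> omap P h"
      using that rep_A_mono[of k h x] rep_rep[of k h l x] order_trans[OF that(2,1)] by simp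
  qed
  have graph_P: "graph P P (Id Psh P) h = {(tag l y, tag k x) | k l x y.
      x \<in> A k \<and> y \<in> A l \<and> h \<le> k \<and> h \<le> l \<and> (y, x) \<in> F h}" for h
  proof -
    have *: "rep h x = rep h y \<longleftrightarrow> (y, x) \<in> F h" if "x \<in> A k" "y \<in> A l" "h \<le> k" "h \<le> l" for k l x y
    proof
      have x: "(rep h x, x) \<in> F h" and y: "(rep h y, y) \<in> F h"
        using that A_iff down rep by blast+
      show "(y, x) \<in> F h" if "rep h x = rep h y"
        using trans[OF sym[OF y]] x that by simp
    qed (simp add: rep_eq)
    show ?thesis
      unfolding graph_Id[OF P] by (simp add: * cong: conj_cong)
  qed
  \<comment> \<open>At stage \<open>h\<close> a class from a stage \<open>k\<close> above
    \<open>h\<close> is matched with every member of the class at \<open>h\<close> that contains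
    it.\<close>
  define \<theta> where "\<theta> h = {(y, tag k x) | k x y. h \<le> k \<and> x \<in> A k \<and> (y, x) \<in> F h}" for h
  have "antimono \<theta>"
  proof (rule antimonoI)
    fix h k :: 'h assume "k \<le> h"
    then show "\<theta> h \<subseteq> \<theta> k"
      using down[OF \<open>k \<le> h\<close>] order_trans[OF \<open>k \<le> h\<close>] unfolding \<theta>_def by blast
  qed
  moreover have "\<theta> h \<subseteq> X \<times> elements P" for h
    using sub by (auto simp: \<theta>_def elements_def)
  moreover have "\<theta> h O graph P P (Id Psh P) h = \<theta> h" for h
  proof
    show "\<theta> h O graph P P (Id Psh P) h \<subseteq> \<theta> h"
      by (auto simp: graph_P \<theta>_def) (metis trans)
    show "\<theta> h \<subseteq> \<theta> h O graph P P (Id Psh P) h"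
    proof
      fix p assume "p \<in> \<theta> h"
      then obtain k x y where p: "p = (y, tag k x)" "h \<le> k" "x \<in> A k" "(y, x) \<in> F h"
        by (auto simp: \<theta>_def)
      then have "(tag k x, tag k x) \<in> graph P P (Id Psh P) h"
        using down A_iff by (auto simp: graph_P)
      then show "p \<in> \<theta> h O graph P P (Id Psh P) h"
        using \<open>p \<in> \<theta> h\<close> p by blast
    qed
  qed
  moreover have "F h O \<theta> h = \<theta> h" for h
  proof
    show "F h O \<theta> h \<subseteq> \<theta> h"
      by (auto simp: \<theta>_def) (metis trans)
    show "\<theta> h \<subseteq> F h O \<theta> h"
    proof
      fix p assume "p \<in> \<theta> h"
      then obtain y a where p: "p = (y, a)" "(y, a) \<in> \<theta> h" and "\<exists>x. (y, x) \<in> F h"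
        by (auto simp: \<theta>_def)
      then have "(y, y) \<in> F h"
        using sym trans by blast
      then show "p \<in> F h O \<theta> h"
        using p by blast
    qed
  qed
  \<comment> \<open>Equality here, as in the next claim, supplies at once a bound for the morphism
    and a bound for its invertibility.\<close>
  moreover have "graph P P (Id Psh P) h = (\<theta> h)\<inverse> O \<theta> h" for h
  proof
    show "graph P P (Id Psh P) h \<subseteq> (\<theta> h)\<inverse> O \<theta> h"
    proof
      fix p assume "p \<in> graph P P (Id Psh P) h"
      then obtain k l x y where p: "p = (tag l y, tag k x)" "x \<in> A k" "y \<in> A l" "h \<le> k" "h \<le> l"
        "(y, x) \<in> F h"
        by (auto simp: graph_P)
      then have "(x, tag k x) \<in> \<theta> h" "(x, tag l y) \<in> \<theta> h"
        using sym[OF p(6)] trans[OF sym[OF p(6)] p(6)] by (auto simp: \<theta>_def)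
      then show "p \<in> (\<theta> h)\<inverse> O \<theta> h"
        using p(1) by blast
    qed
    show "(\<theta> h)\<inverse> O \<theta> h \<subseteq> graph P P (Id Psh P) h"
      by (auto simp: graph_P \<theta>_def) (metis sym trans)
  qed
  moreover have "\<theta> h O (\<theta> h)\<inverse> = F h" for h
  proof
    show "\<theta> h O (\<theta> h)\<inverse> \<subseteq> F h"
      by (auto simp: \<theta>_def intro: sym trans)
    show "F h \<subseteq> \<theta> h O (\<theta> h)\<inverse>"
    proof (rule subrelI)
      fix x y assume xy: "(x, y) \<in> F h"
      \<comment> \<open>The class of \<open>y\<close> at stage \<open>h\<close> itself, tagged with
        \<open>h\<close>, is the middle element joining \<open>x\<close> and
        \<open>y\<close>.\<close>
      have "rep h y \<in> A h" "(rep h y, y) \<in> F h"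
        using rep_A[OF xy] rep[OF xy] by auto
      then have "(x, tag h (rep h y)) \<in> \<theta> h" "(y, tag h (rep h y)) \<in> \<theta> h"
        using trans[OF xy sym[OF \<open>(rep h y, y) \<in> F h\<close>]] sym[OF \<open>(rep h y, y) \<in> F h\<close>]
        by (auto simp: \<theta>_def)
      then show "(x, y) \<in> \<theta> h O (\<theta> h)\<inverse>"
        by blast
    qed
  qed
  ultimately have "is_iso Rel (elements P, graph P P (Id Psh P)) (X, F) \<theta>"
    using am antimono_graph[OF P P Id_Psh_Hom[OF P]]
    by (intro is_iso_relational_presheaf_cat F relational_presheaf_elements[OF P])
      (auto simp: relational_presheaf_hom_iff)
  then show ?thesis
    using P by (auto simp: XF rel_of_def)
qed

theorem equivalent_Psh_Rel: "equivalent_categories Psh Rel"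
  by (intro equivalent_categories_if_fully_faithful_eso[of _ _ rel_of] category_presheaf_cat
    category_relational_presheaf_cat is_functor_rel_of fully_faithful_rel_of
    essentially_surjective_rel_of)

end

section \<open>Tagging inside the universe\<close>

lemma tagged_universe_exists:
  assumes "set_universe small" "small_type small TYPE('h::complete_lattice)"
  obtains tag :: "'h::complete_lattice \<Rightarrow> 'u \<Rightarrow> 'u" where "tagged_universe small tag"
proof -
  interpret set_universe small by (rule assms)
  obtain pair :: "'u \<times> 'u \<Rightarrow> 'u" where pair: "inj pair"
    using pairing by blast
  obtain e :: "'h \<Rightarrow> 'u" where e: "inj e" "small (range e)"
    using assms(2) by (auto simp: small_type_def)
  define tag where "tag h x = pair (e h, x)" for h x
  have small_tagged: "small (\<Union>h. tag h ` A h)" if "\<And>h. small (A h)" for A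
  proof -
    \<comment> \<open>Closure under unions concerns families indexed by small subsets of
      \<open>'u\<close>, so the union is reindexed along \<open>e\<close> and decoded by
      \<open>inv e\<close>.\<close>
    have "small (\<Union>u\<in>range e. tag (inv e u) ` A (inv e u))"
      using that by (intro small_UN small_image e)
    then show ?thesis
      using e by simp
  qed
  have tag_inject: "tag h x = tag k y \<longleftrightarrow> h = k \<and> x = y" for h k x y
    using pair e by (auto simp: tag_def dest: injD)
  have "tagged_universe small tag"
    by unfold_locales (fact tag_inject, rule small_tagged)
  then show ?thesis
    by (rule that)
qed

theorem mainTheorem10:
  fixes small :: "'u set \<Rightarrow> bool"
  assumes "set_universe small"
    and "small_type small TYPE('h::complete_heyting_algebra)"
  shows "equivalent_categories
    (presheaf_cat small :: (('h, unit, 'u set, 'u \<Rightarrow> 'u) cfunctor, 'h \<Rightarrow> 'u \<Rightarrow> 'u) cat)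
    (relational_presheaf_cat small :: ('u set \<times> ('h, 'u) rel_family, ('h, 'u) rel_family) cat)"
proof -
  obtain tag :: "'h \<Rightarrow> 'u \<Rightarrow> 'u" where "tagged_universe small tag"
    using tagged_universe_exists[OF assms] .
  then show ?thesis
    by (rule tagged_universe.equivalent_Psh_Rel)
qed

end
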